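(* Consider the semi-discretization, with unknowns $u(t)\in\mathbb{R}^{n_{ux}n_{uy}}$ and $v(t)\in\mathbb{R}^{n_{vx}n_{vy}}$, $$u_{tt}=\boldsymbol{D_u}u+SAT_{u1}+SAT_{u2}+SAT_{u3}+SAT_{\partial u},\qquad v_{tt}=\boldsymbol{D_v}v+SAT_{v1}+SAT_{v2}+SAT_{v3}+SAT_{\partial v},$$ where $$SAT_{u1}=\tfrac12\boldsymbol{H_{ux}^{-1}}\boldsymbol{S_{ux}^T}\big(\boldsymbol{E_{ux}}u-(E_{uv}\otimes I_{v2u})v\big),$$ $$SAT_{u2}=-\tfrac{\tau}{2}\boldsymbol{H_{ux}^{-1}}\big(\boldsymbol{E_{ux}}u-(E_{uv}\otimes I_{v2u})v\big),$$ $$SAT_{u3}=-\tfrac{\tau}{2}\boldsymbol{H_{ux}^{-1}}\big((E_{ux}\otimes(I_{v2u}I_{u2v}))u-(E_{uv}\otimes I_{v2u})v\big),$$ $$SAT_{\partial u}=-\tfrac12\boldsymbol{H_{ux}^{-1}}\big(\boldsymbol{E_{ux}}\boldsymbol{S_{ux}}u-(E_{uv}\otimes I_{v2u})\boldsymbol{S_{vx}}v\big),$$ $$SAT_{v1}=-\tfrac12\boldsymbol{H_{vx}^{-1}}\boldsymbol{S_{vx}^T}\big(\boldsymbol{E_{vx}}v-(E_{vu}\otimes I_{u2v})u\big),$$ $$SAT_{v2}=-\tfrac{\tau}{2}\boldsymbol{H_{vx}^{-1}}\big(\boldsymbol{E_{vx}}v-(E_{vu}\otimes I_{u2v})u\big),$$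 $$SAT_{v3}=-\tfrac{\tau}{2}\boldsymbol{H_{vx}^{-1}}\big((E_{vx}\otimes(I_{u2v}I_{v2u}))v-(E_{vu}\otimes I_{u2v})u\big),$$ $$SAT_{\partial v}=\tfrac12\boldsymbol{H_{vx}^{-1}}\big(\boldsymbol{E_{vx}}\boldsymbol{S_{vx}}v-(E_{vu}\otimes I_{u2v})\boldsymbol{S_{ux}}u\big).$$ If the interpolation operators $I_{u2v}$ and $I_{v2u}$ are norm-compatible, then this semi-discretization is (energy) stable for every $\tau$ such that $$\tau\geq\max\left(\frac{1}{2\theta h_{ux}},\frac{1}{2\theta h_{vx}}\right),$$ where $\theta>0$ is the constant in the decomposition $M=\widetilde M+h\theta(BS)^TBS$ of the second derivative SBP operators, and $h_{ux}$, $h_{vx}$ are the mesh sizes in the $x$-direction in $\Omega_u$ and $\Omega_v$, respectively.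
   Context: **Problem.** The scheme discretizes $U_{tt}=U_{xx}+U_{yy}$ on the left block $\Omega_u=[0,0.5]\times[0,1]$ and $V_{tt}=V_{xx}+V_{yy}$ on the right block $\Omega_v=[0.5,1]\times[0,1]$, with interface conditions $U=V$, $U_x=V_x$ at $x=0.5$. The blocks carry independent uniform Cartesian grids with $n_{ux}\times n_{uy}$ and $n_{vx}\times n_{vy}$ points; in general $n_{uy}\ne n_{vy}$. The interface is the last grid line in $x$ of $\Omega_u$ and the first grid line in $x$ of $\Omega_v$. **One-dimensional second derivative SBP operators.** On a uniform grid $x_0,\dots,x_N$ with spacing $h$, a diagonal norm second derivative SBP operator is $D_2=H^{-1}(-M+BS)$ approximating $\partial^2/\partial x^2$, where $H$ is diagonal positive definite (the SBP norm), $M$ is symmetric positive semi-definite, $B=\mathrm{diag}(-1,0,\dots,0,1)$, and the first and last rows of $S$ approximate $\partial/\partial x$ at the two boundaries. The operators used satisfy the borrowing property $M=\widetilde M+h\theta(BS)^TBS$ with $\widetilde M$ symmetric positive semi-definite and $\theta>0$ a constant independent of $h$. SBP operators of the same accuracy order are used in both blocks and both directions, so $\theta$ is the same for all of them. Subscripts $ux,uy,vx,vy$ on $H,M,\widetilde M,S,B,D_2$ denote the one-dimensional operators for the $x$- or $y$-direction of the grid of $u$ or $v$. **Boundary convention.** Only the interface treatment is considered: terms imposing conditions on the outer boundary are omitted and the outer boundary contributions are dropped. Thus $B$ has only the one nonzero element corresponding to the interface, so $B_{ux}=E_{ux}$, $B_{vx}=-E_{vx}$ (defined below), $B_{uy}=0$,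 $B_{vy}=0$, both in $D_2$ and in the borrowing property. **Two-dimensional operators.** Grid vectors are ordered column-wise ($x$-index outer, $y$-index inner). Bold letters denote Kronecker extensions: an $x$-direction operator $A_{ux}$ gives $\boldsymbol{A_{ux}}=A_{ux}\otimes I_{uy}$ and a $y$-direction operator $A_{uy}$ gives $\boldsymbol{A_{uy}}=I_{ux}\otimes A_{uy}$, with identity matrices $I_{ux},I_{uy}$; similarly for $v$. Then $\boldsymbol{D_u}=D_{2,ux}\otimes I_{uy}+I_{ux}\otimes D_{2,uy}$ and $\boldsymbol{D_v}=D_{2,vx}\otimes I_{vy}+I_{vx}\otimes D_{2,vy}$. **Interface extraction.** $E_{ux}$ is the $n_{ux}\times n_{ux}$ matrix whose only nonzero entry is a $1$ in the last diagonal position; $E_{vx}$ is the $n_{vx}\times n_{vx}$ matrix whose only nonzero entry is a $1$ in the first diagonal position; $E_{uv}$ is the $n_{ux}\times n_{vx}$ matrix whose only nonzero entry is a $1$ in position (last row, first column); $E_{vu}=E_{uv}^T$. **Interpolation operators.** $I_{u2v}\in\mathbb{R}^{n_{vy}\times n_{uy}}$ interpolates interface grid functions from the $u$-grid to the $v$-grid, and $I_{v2u}\in\mathbb{R}^{n_{uy}\times n_{vy}}$ from the $v$-grid to the $u$-grid. They are norm-compatible if $H_{uy}I_{v2u}=(H_{vy}I_{u2v})^T$. **Stability.** A semi-discretization is (energy) stable if it satisfies a discrete energy estimate: there is a non-negative discrete energy $$\mathbf G=u_t^T(H_{ux}\otimes H_{uy})u_t+v_t^T(H_{vx}\otimes H_{vy})v_t+q(u,v),$$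 with $q$ a quadratic form satisfying $q(u,v)\ge0$ for all $u,v$, such that $\frac{d}{dt}\mathbf G=0$ for all solutions. *)

theory Defs
  imports "HOL-Analysis.Analysis" "HOL-Computational_Algebra.Polynomial"
begin

section \<open>Grids and matrices\<close>

text \<open>
  The points of a one-dimensional grid are indexed by a finite linearly ordered type, so that
  the number of points is its cardinality and the first and last points are its minimum and
  maximum.
\<close>

type_synonym 'n sqmat = "((real, 'n) vec, 'n) vec"

definition first_pt :: "'n::{finite,linorder}" where
  "first_pt = Min UNIV"

definition last_pt :: "'n::{finite,linorder}" where
  "last_pt = Max UNIV"

definition spacing :: "'n::finite itself \<Rightarrow> real \<Rightarrow> real \<Rightarrow> real" where
  "spacing _ a b = (b - a) / (real CARD('n) - 1)"

definition grid_point :: "real \<Rightarrow> real \<Rightarrow> 'n::{finite,linorder} \<Rightarrow> real" where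
  "grid_point a b i = a + real (card {j. j < i}) * spacing TYPE('n) a b"

definition grid_fun :: "real \<Rightarrow> real \<Rightarrow> (real \<Rightarrow> real) \<Rightarrow> real ^ 'n::{finite,linorder}" where
  "grid_fun a b f = (\<chi> i. f (grid_point a b i))"

definition unit_entry :: "'r \<Rightarrow> 'c \<Rightarrow> real ^ 'c::finite ^ 'r::finite" where
  "unit_entry r c = (\<chi> i j. if i = r \<and> j = c then 1 else 0)"

definition diagonal :: "'n::finite sqmat \<Rightarrow> bool" where
  "diagonal A \<longleftrightarrow> (\<forall>i j. i \<noteq> j \<longrightarrow> A $ i $ j = 0)"

definition pos_def :: "'n::finite sqmat \<Rightarrow> bool" where
  "pos_def A \<longleftrightarrow> transpose A = A \<and> (\<forall>x. x \<noteq> 0 \<longrightarrow> x \<bullet> (A *v x) > 0)"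

definition pos_semidef :: "'n::finite sqmat \<Rightarrow> bool" where
  "pos_semidef A \<longleftrightarrow> transpose A = A \<and> (\<forall>x. x \<bullet> (A *v x) \<ge> 0)"

text \<open>
  Kronecker product.  Two-dimensional grid vectors have index type \<open>'x \<times> 'y\<close>; the column-wise
  ordering (\<open>x\<close> outer, \<open>y\<close> inner) is the lexicographic enumeration of these pairs.
\<close>

definition kron ::
    "real ^ 'b ^ 'a \<Rightarrow> real ^ 'd ^ 'c \<Rightarrow> real ^ ('b \<times> 'd) ^ ('a \<times> 'c)"  (infixl "\<otimes>" 75) where
  "A \<otimes> B = (\<chi> i j. A $ fst i $ fst j * B $ snd i $ snd j)"

abbreviation x_ext :: "real ^ 'b ^ 'a \<Rightarrow> real ^ ('b \<times> 'y) ^ ('a \<times> 'y::finite)" where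
  "x_ext A \<equiv> A \<otimes> mat 1"

abbreviation y_ext :: "real ^ 'd ^ 'c \<Rightarrow> real ^ ('x \<times> 'd) ^ ('x::finite \<times> 'c)" where
  "y_ext A \<equiv> mat 1 \<otimes> A"

definition E_ux :: "'n::{finite,linorder} sqmat" where
  "E_ux = unit_entry last_pt last_pt"

definition E_vx :: "'n::{finite,linorder} sqmat" where
  "E_vx = unit_entry first_pt first_pt"

definition E_uv :: "real ^ 'vx::{finite,linorder} ^ 'ux::{finite,linorder}" where
  "E_uv = unit_entry last_pt first_pt"

definition E_vu :: "real ^ 'ux::{finite,linorder} ^ 'vx::{finite,linorder}" where
  "E_vu = transpose E_uv"

section \<open>Summation-by-parts operators\<close>

definition D2_op :: "'n::finite sqmat \<Rightarrow> 'n sqmat \<Rightarrow> 'n sqmat \<Rightarrow> 'n sqmat \<Rightarrow> 'n sqmat"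
  where "D2_op H M B S = matrix_inv H ** (- M + B ** S)"

definition B_full :: "'n::{finite,linorder} sqmat" where
  "B_full = unit_entry last_pt last_pt - unit_entry first_pt first_pt"

text \<open>
  \<open>sbp_operator p a b H M S\<close>: diagonal norm second derivative SBP operator on the uniform grid on
  \<open>[a, b]\<close> with both boundary terms present.  ``Approximates'' is expressed by exactness on
  polynomials: an approximation of the \<open>k\<close>-th derivative of order \<open>p\<close> is exact on polynomials of
  degree less than \<open>p + k\<close>.  Here \<open>p \<ge> 1\<close> is the order guaranteed at every grid point (typically
  it is attained at the boundary, the interior stencil being more accurate).  Only the first and
  last rows of \<open>S\<close> matter.
\<close>

definition sbp_operator ::
    "nat \<Rightarrow> real \<Rightarrow> real \<Rightarrow> 'n sqmat \<Rightarrow> 'n sqmat \<Rightarrow> 'n::{finite,linorder} sqmat \<Rightarrow> bool"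
  where
  "sbp_operator p a b H M S \<longleftrightarrow>
     p \<ge> 1 \<and> CARD('n) \<ge> 2 \<and> diagonal H \<and> pos_def H \<and> pos_semidef M \<and>
     (\<forall>f. degree f < p + 2 \<longrightarrow>
        D2_op H M B_full S *v grid_fun a b (poly f) = grid_fun a b (poly (pderiv (pderiv f)))) \<and>
     (\<forall>f. degree f < p + 1 \<longrightarrow> (\<forall>i \<in> {first_pt, last_pt}.
        (S *v grid_fun a b (poly f)) $ i = grid_fun a b (poly (pderiv f)) $ i))"

definition borrowing :: "real \<Rightarrow> real \<Rightarrow> 'n::finite sqmat \<Rightarrow> 'n sqmat \<Rightarrow> 'n sqmat \<Rightarrow> bool" where
  "borrowing \<theta> h M B S \<longleftrightarrow>
     (\<exists>Mt. pos_semidef Mt \<and> M = Mt + (h * \<theta>) *\<^sub>R (transpose (B ** S) ** (B ** S)))"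

definition norm_compatible ::
    "'uy sqmat \<Rightarrow> 'vy sqmat \<Rightarrow> real ^ 'uy ^ 'vy \<Rightarrow> real ^ 'vy ^ 'uy \<Rightarrow> bool" where
  "norm_compatible Huy Hvy Iu2v Iv2u \<longleftrightarrow> Huy ** Iv2u = transpose (Hvy ** Iu2v)"

section \<open>The semi-discretization\<close>

text \<open>
  Contributions of the outer boundary are dropped, so the matrix \<open>B\<close> entering the scheme is
  \<open>E_ux\<close> for \<open>u\<close> and \<open>- E_vx\<close> for \<open>v\<close> in the \<open>x\<close>-direction, and zero in the \<open>y\<close>-direction.
\<close>

definition D_u ::
    "'ux sqmat \<Rightarrow> 'ux sqmat \<Rightarrow> 'ux sqmat \<Rightarrow>
     'uy::finite sqmat \<Rightarrow> 'uy sqmat \<Rightarrow> 'uy sqmat \<Rightarrow>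
     real ^ ('ux \<times> 'uy) ^ ('ux::{finite,linorder} \<times> 'uy)" where
  "D_u Hux Mux Sux Huy Muy Suy =
     x_ext (D2_op Hux Mux E_ux Sux) + y_ext (D2_op Huy Muy 0 Suy)"

definition D_v ::
    "'vx sqmat \<Rightarrow> 'vx sqmat \<Rightarrow> 'vx sqmat \<Rightarrow>
     'vy::finite sqmat \<Rightarrow> 'vy sqmat \<Rightarrow> 'vy sqmat \<Rightarrow>
     real ^ ('vx \<times> 'vy) ^ ('vx::{finite,linorder} \<times> 'vy)" where
  "D_v Hvx Mvx Svx Hvy Mvy Svy =
     x_ext (D2_op Hvx Mvx (- E_vx) Svx) + y_ext (D2_op Hvy Mvy 0 Svy)"

definition SAT_u1 ::
    "'ux sqmat \<Rightarrow> 'ux sqmat \<Rightarrow> real ^ 'vy ^ 'uy \<Rightarrow>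
     real ^ ('ux::{finite,linorder} \<times> 'uy::finite) \<Rightarrow> real ^ ('vx::{finite,linorder} \<times> 'vy::finite) \<Rightarrow>
     real ^ ('ux \<times> 'uy)" where
  "SAT_u1 Hux Sux Iv2u u v =
     (1 / 2) *\<^sub>R (x_ext (matrix_inv Hux) *v (x_ext (transpose Sux) *v
       (x_ext E_ux *v u - (E_uv \<otimes> Iv2u) *v v)))"

definition SAT_u2 ::
    "'ux sqmat \<Rightarrow> real \<Rightarrow> real ^ 'vy ^ 'uy \<Rightarrow>
     real ^ ('ux::{finite,linorder} \<times> 'uy::finite) \<Rightarrow> real ^ ('vx::{finite,linorder} \<times> 'vy::finite) \<Rightarrow>
     real ^ ('ux \<times> 'uy)" where
  "SAT_u2 Hux \<tau> Iv2u u v =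
     - (\<tau> / 2) *\<^sub>R (x_ext (matrix_inv Hux) *v (x_ext E_ux *v u - (E_uv \<otimes> Iv2u) *v v))"

definition SAT_u3 ::
    "'ux sqmat \<Rightarrow> real \<Rightarrow> real ^ 'uy ^ 'vy \<Rightarrow> real ^ 'vy ^ 'uy \<Rightarrow>
     real ^ ('ux::{finite,linorder} \<times> 'uy::finite) \<Rightarrow> real ^ ('vx::{finite,linorder} \<times> 'vy::finite) \<Rightarrow>
     real ^ ('ux \<times> 'uy)" where
  "SAT_u3 Hux \<tau> Iu2v Iv2u u v =
     - (\<tau> / 2) *\<^sub>R (x_ext (matrix_inv Hux) *v
       ((E_ux \<otimes> (Iv2u ** Iu2v)) *v u - (E_uv \<otimes> Iv2u) *v v))"

definition SAT_du ::
    "'ux sqmat \<Rightarrow> 'ux sqmat \<Rightarrow> 'vx sqmat \<Rightarrow> real ^ 'vy ^ 'uy \<Rightarrow>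
     real ^ ('ux::{finite,linorder} \<times> 'uy::finite) \<Rightarrow> real ^ ('vx::{finite,linorder} \<times> 'vy::finite) \<Rightarrow>
     real ^ ('ux \<times> 'uy)" where
  "SAT_du Hux Sux Svx Iv2u u v =
     - (1 / 2) *\<^sub>R (x_ext (matrix_inv Hux) *v
       (x_ext E_ux *v (x_ext Sux *v u) - (E_uv \<otimes> Iv2u) *v (x_ext Svx *v v)))"

definition SAT_v1 ::
    "'vx sqmat \<Rightarrow> 'vx sqmat \<Rightarrow> real ^ 'uy ^ 'vy \<Rightarrow>
     real ^ ('ux::{finite,linorder} \<times> 'uy::finite) \<Rightarrow> real ^ ('vx::{finite,linorder} \<times> 'vy::finite) \<Rightarrow>
     real ^ ('vx \<times> 'vy)" where
  "SAT_v1 Hvx Svx Iu2v u v =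
     - (1 / 2) *\<^sub>R (x_ext (matrix_inv Hvx) *v (x_ext (transpose Svx) *v
       (x_ext E_vx *v v - (E_vu \<otimes> Iu2v) *v u)))"

definition SAT_v2 ::
    "'vx sqmat \<Rightarrow> real \<Rightarrow> real ^ 'uy ^ 'vy \<Rightarrow>
     real ^ ('ux::{finite,linorder} \<times> 'uy::finite) \<Rightarrow> real ^ ('vx::{finite,linorder} \<times> 'vy::finite) \<Rightarrow>
     real ^ ('vx \<times> 'vy)" where
  "SAT_v2 Hvx \<tau> Iu2v u v =
     - (\<tau> / 2) *\<^sub>R (x_ext (matrix_inv Hvx) *v (x_ext E_vx *v v - (E_vu \<otimes> Iu2v) *v u))"

definition SAT_v3 ::
    "'vx sqmat \<Rightarrow> real \<Rightarrow> real ^ 'uy ^ 'vy \<Rightarrow> real ^ 'vy ^ 'uy \<Rightarrow>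
     real ^ ('ux::{finite,linorder} \<times> 'uy::finite) \<Rightarrow> real ^ ('vx::{finite,linorder} \<times> 'vy::finite) \<Rightarrow>
     real ^ ('vx \<times> 'vy)" where
  "SAT_v3 Hvx \<tau> Iu2v Iv2u u v =
     - (\<tau> / 2) *\<^sub>R (x_ext (matrix_inv Hvx) *v
       ((E_vx \<otimes> (Iu2v ** Iv2u)) *v v - (E_vu \<otimes> Iu2v) *v u))"

definition SAT_dv ::
    "'vx sqmat \<Rightarrow> 'ux sqmat \<Rightarrow> 'vx sqmat \<Rightarrow> real ^ 'uy ^ 'vy \<Rightarrow>
     real ^ ('ux::{finite,linorder} \<times> 'uy::finite) \<Rightarrow> real ^ ('vx::{finite,linorder} \<times> 'vy::finite) \<Rightarrow>
     real ^ ('vx \<times> 'vy)" where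
  "SAT_dv Hvx Sux Svx Iu2v u v =
     (1 / 2) *\<^sub>R (x_ext (matrix_inv Hvx) *v
       (x_ext E_vx *v (x_ext Svx *v v) - (E_vu \<otimes> Iu2v) *v (x_ext Sux *v u)))"

section \<open>Energy stability\<close>

definition quadratic_form :: "('a::real_vector \<Rightarrow> real) \<Rightarrow> bool" where
  "quadratic_form q \<longleftrightarrow> (\<exists>b. bilinear b \<and> (\<forall>x. q x = b x x))"

text \<open>
  \<open>(u, v)\<close> solves \<open>u_tt = Fu u v\<close>, \<open>v_tt = Fv u v\<close> for \<open>t \<ge> 0\<close>, and \<open>ut\<close>, \<open>vt\<close> are its first time
  derivatives.
\<close>

definition solves ::
    "('a::real_normed_vector \<Rightarrow> 'b::real_normed_vector \<Rightarrow> 'a) \<Rightarrow> ('a \<Rightarrow> 'b \<Rightarrow> 'b) \<Rightarrow>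
     (real \<Rightarrow> 'a) \<Rightarrow> (real \<Rightarrow> 'b) \<Rightarrow> (real \<Rightarrow> 'a) \<Rightarrow> (real \<Rightarrow> 'b) \<Rightarrow> bool" where
  "solves Fu Fv u v ut vt \<longleftrightarrow> (\<forall>t \<ge> 0.
     (u has_vector_derivative ut t) (at t within {0..}) \<and>
     (v has_vector_derivative vt t) (at t within {0..}) \<and>
     (ut has_vector_derivative Fu (u t) (v t)) (at t within {0..}) \<and>
     (vt has_vector_derivative Fv (u t) (v t)) (at t within {0..}))"

definition energy ::
    "'m sqmat \<Rightarrow> 'n sqmat \<Rightarrow> ((real ^ 'm) \<times> (real ^ 'n) \<Rightarrow> real) \<Rightarrow>
     real ^ 'm \<Rightarrow> real ^ 'n \<Rightarrow> real ^ 'm \<Rightarrow> real ^ 'n \<Rightarrow> real" where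
  "energy Hu Hv q u v ut vt = ut \<bullet> (Hu *v ut) + vt \<bullet> (Hv *v vt) + q (u, v)"

definition energy_stable ::
    "'m sqmat \<Rightarrow> 'n sqmat \<Rightarrow>
     (real ^ 'm \<Rightarrow> real ^ 'n \<Rightarrow> real ^ 'm) \<Rightarrow> (real ^ 'm \<Rightarrow> real ^ 'n \<Rightarrow> real ^ 'n) \<Rightarrow> bool" where
  "energy_stable Hu Hv Fu Fv \<longleftrightarrow>
     (\<exists>q. quadratic_form q \<and> (\<forall>u v. q (u, v) \<ge> 0) \<and>
        (\<forall>u v ut vt. energy Hu Hv q u v ut vt \<ge> 0) \<and>
        (\<forall>u v ut vt. solves Fu Fv u v ut vt \<longrightarrow>
           (\<forall>t \<ge> 0. ((\<lambda>s. energy Hu Hv q (u s) (v s) (ut s) (vt s))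
              has_real_derivative 0) (at t within {0..}))))"

end

theory Submission
  imports Defs
begin

text \<open>
  Multiplied by the block norms \<open>Hux \<otimes> Huy\<close> and \<open>Hvx \<otimes> Hvy\<close>, the right-hand side of the scheme is
  minus a symmetric operator on the pair \<open>(u, v)\<close>.  So the scheme is \<open>H w_tt = - K w\<close> with \<open>K\<close>
  symmetric, and \<open>w_t \<bullet> H w_t + w \<bullet> K w\<close> is conserved (\<open>energy_stableI\<close>).  What has to be shown is
  that \<open>K\<close> is symmetric and positive semi-definite.

  Let \<open>a\<close>, \<open>b\<close> be the restrictions of \<open>u\<close>, \<open>v\<close> to the interface, \<open>\<alpha>\<close>, \<open>\<beta>\<close> those of \<open>S u\<close>, \<open>S v\<close>,
  and put \<open>P = Iu2v\<close>, \<open>Q = Iv2u\<close>.  Norm-compatibility says that \<open>P\<close> and \<open>Q\<close> are adjoint with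
  respect to the inner products that \<open>Huy\<close> and \<open>Hvy\<close> define on the interface.  Hence the interface
  terms can be regrouped around the two jumps, \<open>a - Q b\<close> seen from the left and \<open>b - P a\<close> seen from
  the right, and the quadratic form of \<open>K\<close> becomes the sum of
    \<open>u \<bullet> (Mux \<otimes> Huy + Hux \<otimes> Muy) u - \<langle>\<alpha>, a - Q b\<rangle> + \<tau>/2 |a - Q b|^2\<close>
  and of its mirror image on the right, in which the outward normal derivative is \<open>- \<beta>\<close>
  (\<open>weak_coupled_rhs\<close>, where the polarised form appears; its symmetry is \<open>block_potential_commute\<close>).

  Each of the two summands is non-negative by itself.  The only indefinite term is the product of
  normal derivative and jump.  The borrowing property provides \<open>\<theta> h |\<alpha>|^2\<close> from the stiffness
  (\<open>borrowed_normal_derivative\<close>), the penalty provides \<open>\<tau>/2 |a - Q b|^2\<close>, and the product of the two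
  coefficients is at least \<open>1/4\<close> exactly when \<open>\<tau> \<ge> 1 / (2 \<theta> h)\<close> (\<open>completed_square_nonneg\<close>).

  The two blocks are mirror images: they differ in the sign \<open>s\<close> of the outward normal at the
  interface (\<open>1\<close> on the left, \<open>- 1\<close> on the right) and in the position \<open>r\<close> of the interface grid
  line.  Everything up to the coupling is therefore proved once, for a block with parameters \<open>s\<close>, \<open>r\<close>.
\<close>

section \<open>Kronecker products and grid lines\<close>

lemma sum_prod_UNIV:
  "(\<Sum>k\<in>(UNIV :: ('a::finite \<times> 'b::finite) set). f k) = (\<Sum>i\<in>UNIV. \<Sum>j\<in>UNIV. f (i, j))"
  by (simp add: sum.cartesian_product flip: UNIV_Times_UNIV)

lemma kron_mult: "(A \<otimes> B) ** (C \<otimes> D) = (A ** C) \<otimes> (B ** D)"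
  by (simp add: kron_def matrix_matrix_mult_def vec_eq_iff sum_prod_UNIV sum_product mult_ac)

lemma kron_mult_vec: "(A \<otimes> B) *v ((C \<otimes> D) *v w) = ((A ** C) \<otimes> (B ** D)) *v w"
  by (simp add: matrix_vector_mul_assoc kron_mult)

lemma transpose_kron: "transpose (A \<otimes> B) = transpose A \<otimes> transpose B"
  by (simp add: kron_def transpose_def)

lemma kron_add_left: "(A + B) \<otimes> C = A \<otimes> C + B \<otimes> C"
  by (simp add: kron_def vec_eq_iff algebra_simps)

lemma kron_diff_left: "(A - B) \<otimes> C = A \<otimes> C - B \<otimes> C"
  by (simp add: kron_def vec_eq_iff algebra_simps)

lemma kron_uminus_right: "A \<otimes> (- C) = - (A \<otimes> C)"
  by (simp add: kron_def vec_eq_iff)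

lemma kron_scaleR_left: "(c *\<^sub>R A) \<otimes> C = c *\<^sub>R (A \<otimes> C)"
  by (simp add: kron_def vec_eq_iff)

lemma inner_matrix_vector:
  fixes A :: "real ^ 'b::finite ^ 'a::finite"
  shows "x \<bullet> (A *v y) = (transpose A *v x) \<bullet> y"
  by (simp add: dot_lmul_matrix matrix_transpose_mul flip: vector_transpose_matrix)

lemma matrix_vector_mult_minus_left:
  fixes A :: "real ^ 'b::finite ^ 'a::finite"
  shows "(- A) *v x = - (A *v x)"
  using scaleR_matrix_vector_assoc[of "- 1" A x] by simp

lemma symmetric_inner_commute:
  fixes A :: "'n::finite sqmat"
  assumes "transpose A = A"
  shows "x \<bullet> (A *v y) = y \<bullet> (A *v x)"
  using assms by (metis inner_commute inner_matrix_vector)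

definition grid_line :: "'m \<Rightarrow> real ^ ('m::finite \<times> 'k::finite) \<Rightarrow> real ^ 'k" where
  "grid_line r w = (\<chi> j. w $ (r, j))"

lemma grid_line_add: "grid_line r (v + w) = grid_line r v + grid_line r w"
  by (simp add: grid_line_def vec_eq_iff)

lemma grid_line_scaleR: "grid_line r (c *\<^sub>R w) = c *\<^sub>R grid_line r w"
  by (simp add: grid_line_def vec_eq_iff)

text \<open>
  The matrices that restrict to the interface or couple the blocks have this shape: they read one
  grid line, act along the interface, and write to one grid line.  Weakly, they live on the interface.
\<close>

lemma inner_unit_entry_kron:
  "w \<bullet> ((unit_entry r c \<otimes> A) *v z) = grid_line r w \<bullet> (A *v grid_line c z)"
proof -
  have "((unit_entry r c \<otimes> A) *v z) $ (i, j) = (if i = r then (A *v grid_line c z) $ j else 0)" for i j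
  proof -
    have "((unit_entry r c \<otimes> A) *v z) $ (i, j)
        = (\<Sum>k\<in>UNIV. if k = c then (if i = r then \<Sum>l\<in>UNIV. A $ j $ l * z $ (k, l) else 0) else 0)"
      unfolding matrix_vector_mult_def kron_def unit_entry_def
      by (simp only: sum_prod_UNIV vec_lambda_beta fst_conv snd_conv) (intro sum.cong refl, auto)
    also have "\<dots> = (if i = r then (A *v grid_line c z) $ j else 0)"
      by (simp add: matrix_vector_mult_def grid_line_def)
    finally show ?thesis .
  qed
  then have "w \<bullet> ((unit_entry r c \<otimes> A) *v z)
      = (\<Sum>i\<in>UNIV. if i = r then (\<Sum>j\<in>UNIV. w $ (i, j) * (A *v grid_line c z) $ j) else 0)"
    unfolding inner_vec_def by (simp only: sum_prod_UNIV) (intro sum.cong refl, simp)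
  also have "\<dots> = grid_line r w \<bullet> (A *v grid_line c z)"
    by (simp add: inner_vec_def grid_line_def)
  finally show ?thesis .
qed

lemma diagonal_entry_nonneg:
  assumes "diagonal H" "pos_semidef H"
  shows "H $ j $ j \<ge> 0"
proof -
  have "axis j 1 \<bullet> (H *v axis j 1) \<ge> 0"
    using assms unfolding pos_semidef_def by blast
  then show ?thesis
    by (simp add: inner_axis' matrix_vector_mult_basis column_def)
qed

text \<open>
  With a diagonal factor, the two-dimensional quadratic form splits into a non-negatively weighted
  sum of the one-dimensional forms of \<open>A\<close> along the individual grid lines.
\<close>

lemma pos_semidef_kron_diagonal_right:
  assumes "pos_semidef A" "diagonal H" "pos_semidef H"
  shows "w \<bullet> ((A \<otimes> H) *v w) \<ge> 0"
proof -
  let ?c = "\<lambda>j. \<chi> i. w $ (i, j)"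
  have row: "((A \<otimes> H) *v w) $ (i, j) = H $ j $ j * (A *v ?c j) $ i" for i j
  proof -
    have "((A \<otimes> H) *v w) $ (i, j)
        = (\<Sum>k\<in>UNIV. \<Sum>l\<in>UNIV. if l = j then A $ i $ k * H $ j $ j * w $ (k, j) else 0)"
      unfolding matrix_vector_mult_def kron_def using assms(2)
      by (simp only: sum_prod_UNIV vec_lambda_beta fst_conv snd_conv)
        (intro sum.cong refl, auto simp: diagonal_def)
    also have "\<dots> = H $ j $ j * (A *v ?c j) $ i"
      by (simp add: matrix_vector_mult_def sum_distrib_left mult_ac)
    finally show ?thesis .
  qed
  have "w \<bullet> ((A \<otimes> H) *v w) = (\<Sum>i\<in>UNIV. \<Sum>j\<in>UNIV. w $ (i, j) * (H $ j $ j * (A *v ?c j) $ i))"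
    by (simp add: inner_vec_def sum_prod_UNIV row)
  also have "\<dots> = (\<Sum>j\<in>UNIV. H $ j $ j * (?c j \<bullet> (A *v ?c j)))"
    by (subst sum.swap) (simp add: inner_vec_def sum_distrib_left mult_ac)
  also have "\<dots> \<ge> 0"
    using assms(1) diagonal_entry_nonneg[OF assms(2,3)]
    by (intro sum_nonneg mult_nonneg_nonneg) (auto simp: pos_semidef_def)
  finally show ?thesis .
qed

lemma pos_semidef_kron_diagonal_left:
  assumes "pos_semidef A" "diagonal H" "pos_semidef H"
  shows "w \<bullet> ((H \<otimes> A) *v w) \<ge> 0"
proof -
  have row: "((H \<otimes> A) *v w) $ (i, j) = H $ i $ i * (A *v grid_line i w) $ j" for i j
  proof -
    have "((H \<otimes> A) *v w) $ (i, j)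
        = (\<Sum>k\<in>UNIV. if k = i then (\<Sum>l\<in>UNIV. H $ i $ i * A $ j $ l * w $ (i, l)) else 0)"
      unfolding matrix_vector_mult_def kron_def using assms(2)
      by (simp only: sum_prod_UNIV vec_lambda_beta fst_conv snd_conv)
        (intro sum.cong refl, auto simp: diagonal_def)
    also have "\<dots> = H $ i $ i * (A *v grid_line i w) $ j"
      by (simp add: matrix_vector_mult_def sum_distrib_left mult_ac grid_line_def)
    finally show ?thesis .
  qed
  have "w \<bullet> ((H \<otimes> A) *v w) = (\<Sum>i\<in>UNIV. H $ i $ i * (grid_line i w \<bullet> (A *v grid_line i w)))"
    by (simp add: inner_vec_def sum_prod_UNIV row sum_distrib_left mult_ac grid_line_def)
  also have "\<dots> \<ge> 0"
    using assms(1) diagonal_entry_nonneg[OF assms(2,3)]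
    by (intro sum_nonneg mult_nonneg_nonneg) (auto simp: pos_semidef_def)
  finally show ?thesis .
qed

lemma pos_def_imp_pos_semidef: "pos_def H \<Longrightarrow> pos_semidef H"
  unfolding pos_def_def pos_semidef_def by (metis inner_zero_left less_eq_real_def)

lemma pos_def_mult_matrix_inv:
  assumes "pos_def H"
  shows "H ** matrix_inv H = mat 1"
proof -
  have "x = 0" if "H *v x = 0" for x
    using assms that unfolding pos_def_def by (metis inner_zero_right less_irrefl)
  then have "invertible H"
    by (simp add: invertible_left_inverse matrix_left_invertible_ker)
  then show ?thesis
    unfolding invertible_def matrix_inv_def by (rule someI2_ex) simp
qed

section \<open>The semi-discretization of one block in weak form\<close>

text \<open>
  The right-hand side for the block with solution \<open>u\<close>, whose interface is the grid line \<open>r\<close> with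
  outward normal sign \<open>s\<close>; the neighbour has solution \<open>v\<close>, interface line \<open>r'\<close> and derivative
  matrix \<open>Sx'\<close>, \<open>P\<close> interpolates to the neighbour and \<open>Q\<close> from it.  In order: the Laplacian, the
  terms SAT 1, 2 and 3, and the term in the jump of the normal derivative.
\<close>

definition block_rhs ::
  "real \<Rightarrow> 'm \<Rightarrow> 'n \<Rightarrow> 'm sqmat \<Rightarrow> 'm sqmat \<Rightarrow> 'm sqmat \<Rightarrow> 'k sqmat \<Rightarrow> 'k sqmat \<Rightarrow> 'k sqmat \<Rightarrow> 'n sqmat \<Rightarrow>
   real ^ 'k ^ 'l \<Rightarrow> real ^ 'l ^ 'k \<Rightarrow> real \<Rightarrow>
   real ^ ('m::finite \<times> 'k::finite) \<Rightarrow> real ^ ('n::finite \<times> 'l::finite) \<Rightarrow> real ^ ('m \<times> 'k)" where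
  "block_rhs s r r' Hx Mx Sx Hy My Sy Sx' P Q \<tau> u v =
     (let W = x_ext (matrix_inv Hx);
          E = unit_entry r r;
          jump = x_ext E *v u - (unit_entry r r' \<otimes> Q) *v v
      in (x_ext (D2_op Hx Mx (s *\<^sub>R E) Sx) + y_ext (D2_op Hy My 0 Sy)) *v u
         + (s / 2) *\<^sub>R (W *v (x_ext (transpose Sx) *v jump))
         + - (\<tau> / 2) *\<^sub>R (W *v jump)
         + - (\<tau> / 2) *\<^sub>R (W *v ((E \<otimes> (Q ** P)) *v u - (unit_entry r r' \<otimes> Q) *v v))
         + - (s / 2) *\<^sub>R (W *v (x_ext E *v (x_ext Sx *v u)
              - (unit_entry r r' \<otimes> Q) *v (x_ext Sx' *v v))))"

definition stiffness :: "'m sqmat \<Rightarrow> 'm sqmat \<Rightarrow> 'k sqmat \<Rightarrow> 'k sqmat \<Rightarrow> ('m::finite \<times> 'k::finite) sqmat" where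
  "stiffness Hx Mx Hy My = Mx \<otimes> Hy + Hx \<otimes> My"

text \<open>
  Each penalty term carries the inverse norm in the \<open>x\<close>-direction so that testing it in the block
  norm leaves only the norm along the interface.
\<close>

lemma norm_mult_x_inverse:
  assumes "pos_def Hx"
  shows "(Hx \<otimes> Hy) *v (x_ext (matrix_inv Hx) *v w) = y_ext Hy *v w"
  by (simp add: kron_mult_vec pos_def_mult_matrix_inv[OF assms])

text \<open>
  Discrete Green formula: summation by parts leaves the outward flux through the interface.
\<close>

lemma weak_laplacian:
  assumes "pos_def Hx" "pos_def Hy"
  shows "\<phi> \<bullet> ((Hx \<otimes> Hy) *v ((x_ext (D2_op Hx Mx (s *\<^sub>R unit_entry r r) Sx) + y_ext (D2_op Hy My 0 Sy)) *v u))
    = - (\<phi> \<bullet> (stiffness Hx Mx Hy My *v u)) + s * (grid_line r \<phi> \<bullet> (Hy *v grid_line r (x_ext Sx *v u)))"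
proof -
  have x: "Hx ** D2_op Hx Mx (s *\<^sub>R unit_entry r r) Sx = s *\<^sub>R (unit_entry r r ** Sx) - Mx"
    by (simp add: D2_op_def matrix_mul_assoc pos_def_mult_matrix_inv[OF assms(1)] scalar_matrix_assoc)
  have y: "Hy ** D2_op Hy My 0 Sy = - My"
    by (simp add: D2_op_def matrix_mul_assoc pos_def_mult_matrix_inv[OF assms(2)])
  have b: "\<phi> \<bullet> (((unit_entry r r ** Sx) \<otimes> Hy) *v u)
      = grid_line r \<phi> \<bullet> (Hy *v grid_line r (x_ext Sx *v u))"
    using kron_mult_vec[of "unit_entry r r" Hy Sx "mat 1" u]
      inner_unit_entry_kron[of \<phi> r r Hy "x_ext Sx *v u"] by simp
  show ?thesis
    by (simp add: matrix_vector_mult_add_rdistrib matrix_vector_right_distrib kron_mult_vec x y b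
        stiffness_def kron_add_left kron_diff_left kron_uminus_right kron_scaleR_left
        inner_add_right inner_diff_right matrix_vector_mult_diff_rdistrib
        matrix_vector_mult_minus_left scaleR_matrix_vector_assoc[symmetric])
qed

text \<open>
  In weak form SAT 1 moves its transposed derivative onto the test function, and the jump that SAT 3
  penalises is the neighbour's jump \<open>v - P u\<close> interpolated back.
\<close>

lemma weak_block_rhs:
  fixes u \<phi> :: "real ^ ('m::finite \<times> 'k::finite)" and v :: "real ^ ('n::finite \<times> 'l::finite)"
  assumes "pos_def Hx" "pos_def Hy"
    and jump: "jump = grid_line r u - Q *v grid_line r' v"
  shows "\<phi> \<bullet> ((Hx \<otimes> Hy) *v block_rhs s r r' Hx Mx Sx Hy My Sy Sx' P Q \<tau> u v)
    = - (\<phi> \<bullet> (stiffness Hx Mx Hy My *v u))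
      + s * (grid_line r \<phi> \<bullet> (Hy *v grid_line r (x_ext Sx *v u)))
      + s / 2 * (grid_line r (x_ext Sx *v \<phi>) \<bullet> (Hy *v jump))
      - \<tau> / 2 * (grid_line r \<phi> \<bullet> (Hy *v jump))
      - \<tau> / 2 * (grid_line r \<phi> \<bullet> (Hy *v (Q *v (P *v grid_line r u - grid_line r' v))))
      - s / 2 * (grid_line r \<phi> \<bullet> (Hy *v (grid_line r (x_ext Sx *v u) - Q *v grid_line r' (x_ext Sx' *v v))))"
proof -
  have line: "w \<bullet> (y_ext Hy *v ((unit_entry r c \<otimes> A) *v z)) = grid_line r w \<bullet> (Hy *v (A *v grid_line c z))"
    for w c and A :: "real ^ 'j::finite ^ 'k" and z :: "real ^ ('i::finite \<times> 'j)"
    by (simp add: kron_mult_vec inner_unit_entry_kron) (simp flip: matrix_vector_mul_assoc)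
  have S: "\<phi> \<bullet> (y_ext Hy *v (x_ext (transpose Sx) *v w)) = (x_ext Sx *v \<phi>) \<bullet> (y_ext Hy *v w)" for w
  proof -
    have "y_ext Hy *v (x_ext (transpose Sx) *v w) = x_ext (transpose Sx) *v (y_ext Hy *v w)"
      by (simp add: kron_mult_vec)
    then show ?thesis
      by (simp add: inner_matrix_vector[of \<phi>] transpose_kron)
  qed
  show ?thesis
    unfolding block_rhs_def Let_def jump
    by (simp add: matrix_vector_right_distrib inner_add_right weak_laplacian[OF assms(1,2)]
        matrix_vector_mult_scaleR norm_mult_x_inverse[OF assms(1)] S line
        matrix_vector_mult_diff_distrib inner_diff_right flip: matrix_vector_mul_assoc)
qed

section \<open>The potential energy\<close>

text \<open>
  The polarised form of \<open>\<tau>/2 |j|^2 - s \<langle>d, j\<rangle>\<close> for a derivative \<open>d\<close> and a jump \<open>j\<close> on the interface.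
\<close>

definition coupling :: "real \<Rightarrow> real \<Rightarrow> 'k::finite sqmat \<Rightarrow> real ^ 'k \<Rightarrow> real ^ 'k \<Rightarrow> real ^ 'k \<Rightarrow> real ^ 'k \<Rightarrow> real" where
  "coupling s \<tau> H d1 j1 d2 j2 =
     \<tau> / 2 * (j1 \<bullet> (H *v j2)) - s / 2 * (d1 \<bullet> (H *v j2)) - s / 2 * (j1 \<bullet> (H *v d2))"

definition block_potential where
  "block_potential s r r' Hx Mx Sx Hy My Q \<tau> \<phi> \<psi> u v =
     \<phi> \<bullet> (stiffness Hx Mx Hy My *v u)
     + coupling s \<tau> Hy (grid_line r (x_ext Sx *v \<phi>)) (grid_line r \<phi> - Q *v grid_line r' \<psi>)
         (grid_line r (x_ext Sx *v u)) (grid_line r u - Q *v grid_line r' v)"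

lemma block_potential_linear_left:
  "block_potential s r r' Hx Mx Sx Hy My Q \<tau> (\<phi> + \<phi>') (\<psi> + \<psi>') u v
    = block_potential s r r' Hx Mx Sx Hy My Q \<tau> \<phi> \<psi> u v
      + block_potential s r r' Hx Mx Sx Hy My Q \<tau> \<phi>' \<psi>' u v"
  "block_potential s r r' Hx Mx Sx Hy My Q \<tau> (c *\<^sub>R \<phi>) (c *\<^sub>R \<psi>) u v
    = c * block_potential s r r' Hx Mx Sx Hy My Q \<tau> \<phi> \<psi> u v"
  unfolding block_potential_def coupling_def
  by (simp_all add: inner_add_left inner_diff_left matrix_vector_right_distrib
      matrix_vector_mult_scaleR grid_line_add grid_line_scaleR algebra_simps)

lemma block_potential_commute:
  assumes "transpose Hx = Hx" "transpose Mx = Mx" "transpose Hy = Hy" "transpose My = My"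
  shows "block_potential s r r' Hx Mx Sx Hy My Q \<tau> \<phi> \<psi> u v
    = block_potential s r r' Hx Mx Sx Hy My Q \<tau> u v \<phi> \<psi>"
proof -
  have st: "transpose (stiffness Hx Mx Hy My) = stiffness Hx Mx Hy My"
    using assms by (simp add: stiffness_def transpose_kron[symmetric] transpose_def kron_def vec_eq_iff)
  show ?thesis
    using symmetric_inner_commute[OF st, of \<phi> u]
      symmetric_inner_commute[OF assms(3)]
    unfolding block_potential_def coupling_def by (smt (verit))
qed

text \<open>
  Completing the square: \<open>k |d|^2 - s \<langle>d, j\<rangle> + \<tau>/2 |j|^2\<close> is \<open>|2 k d - s j|^2 / (4 k)\<close> plus
  \<open>(\<tau>/2 - 1 / (4 k)) |j|^2\<close>, in the seminorm of \<open>H\<close>.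
\<close>

lemma completed_square_nonneg:
  assumes H: "pos_semidef H" and k: "k > 0" and \<tau>: "\<tau> \<ge> 1 / (2 * k)" and s: "s * s = 1"
  shows "k * (d \<bullet> (H *v d)) + coupling s \<tau> H d j d j \<ge> 0"
proof -
  have sym: "j \<bullet> (H *v d) = d \<bullet> (H *v j)"
    using H by (intro symmetric_inner_commute) (simp add: pos_semidef_def)
  let ?D = "d \<bullet> (H *v d)" and ?X = "d \<bullet> (H *v j)" and ?J = "j \<bullet> (H *v j)"
  have "0 \<le> ((2 * k) *\<^sub>R d - s *\<^sub>R j) \<bullet> (H *v ((2 * k) *\<^sub>R d - s *\<^sub>R j))"
    using H by (simp add: pos_semidef_def)
  also have "\<dots> = 4 * k * k * ?D - 4 * k * s * ?X + (s * s) * ?J"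
    by (simp add: matrix_vector_mult_diff_distrib matrix_vector_mult_scaleR inner_diff_left
        inner_diff_right sym algebra_simps)
  finally have "0 \<le> 4 * k * (k * ?D - s * ?X) + ?J"
    using s by (simp add: algebra_simps)
  moreover have "?J \<le> 4 * k * (\<tau> / 2 * ?J)"
  proof -
    have "1 \<le> 2 * k * \<tau>"
      using \<tau> k by (simp add: field_simps)
    then have "1 * ?J \<le> (2 * k * \<tau>) * ?J"
      using H by (intro mult_right_mono) (auto simp: pos_semidef_def)
    then show ?thesis by (simp add: mult_ac)
  qed
  ultimately have "0 \<le> 4 * k * (k * ?D - s * ?X + \<tau> / 2 * ?J)"
    by (simp add: algebra_simps)
  then have "0 \<le> k * ?D - s * ?X + \<tau> / 2 * ?J"
    using k by (simp add: zero_le_mult_iff)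
  then show ?thesis
    by (simp add: coupling_def sym)
qed

text \<open>
  The rank-one part of \<open>Mx\<close> given by the borrowing property sees only the derivative at the
  interface, because the unit entry is a projection and the normal sign squares to one.
\<close>

lemma borrowed_normal_derivative:
  assumes "borrowing \<theta> h Mx (s *\<^sub>R unit_entry r r) Sx" and s: "s * s = 1"
    and "diagonal Hy" "pos_semidef Hy"
  shows "w \<bullet> ((Mx \<otimes> Hy) *v w)
    \<ge> h * \<theta> * (grid_line r (x_ext Sx *v w) \<bullet> (Hy *v grid_line r (x_ext Sx *v w)))"
proof -
  let ?E = "unit_entry r r" and ?d = "x_ext Sx *v w"
  obtain Mt where Mt: "pos_semidef Mt"
    and M: "Mx = Mt + (h * \<theta>) *\<^sub>R (transpose ((s *\<^sub>R ?E) ** Sx) ** ((s *\<^sub>R ?E) ** Sx))"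
    using assms(1) unfolding borrowing_def by blast
  have EE: "transpose ?E ** ?E = ?E"
    by (simp add: unit_entry_def transpose_def matrix_matrix_mult_def vec_eq_iff if_distrib cong: if_cong)
      (auto intro!: sum.neutral)
  have "transpose ((s *\<^sub>R ?E) ** Sx) ** ((s *\<^sub>R ?E) ** Sx) = (s * s) *\<^sub>R (transpose (?E ** Sx) ** (?E ** Sx))"
    by (simp add: transpose_scalar matrix_scalar_ac flip: scalar_matrix_assoc)
  also have "\<dots> = transpose Sx ** (?E ** Sx)"
    using EE s by (simp add: matrix_transpose_mul matrix_mul_assoc) (simp flip: matrix_mul_assoc)
  finally have M': "Mx = Mt + (h * \<theta>) *\<^sub>R (transpose Sx ** (?E ** Sx))"
    using M by simp
  have "((transpose Sx ** (?E ** Sx)) \<otimes> Hy) *v w = x_ext (transpose Sx) *v ((?E \<otimes> Hy) *v ?d)"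
    by (simp add: kron_mult_vec matrix_mul_assoc)
  then have "w \<bullet> (((transpose Sx ** (?E ** Sx)) \<otimes> Hy) *v w) = grid_line r ?d \<bullet> (Hy *v grid_line r ?d)"
    by (simp add: inner_matrix_vector[of w] transpose_kron inner_unit_entry_kron)
  then show ?thesis
    using pos_semidef_kron_diagonal_right[OF Mt assms(3,4), of w]
    by (simp add: M' kron_add_left kron_scaleR_left matrix_vector_mult_add_rdistrib inner_add_right
        scaleR_matrix_vector_assoc[symmetric])
qed

lemma block_potential_nonneg:
  assumes "borrowing \<theta> h Mx (s *\<^sub>R unit_entry r r) Sx" and "s * s = 1"
    and "diagonal Hx" "pos_semidef Hx" "diagonal Hy" "pos_semidef Hy" "pos_semidef My"
    and "\<theta> > 0" "h > 0" "\<tau> \<ge> 1 / (2 * \<theta> * h)"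
  shows "block_potential s r r' Hx Mx Sx Hy My Q \<tau> u v u v \<ge> 0"
proof -
  let ?d = "grid_line r (x_ext Sx *v u)" and ?j = "grid_line r u - Q *v grid_line r' v"
  have "(h * \<theta>) * (?d \<bullet> (Hy *v ?d)) + coupling s \<tau> Hy ?d ?j ?d ?j \<ge> 0"
    using assms by (intro completed_square_nonneg) (auto simp: mult_ac)
  then show ?thesis
    using borrowed_normal_derivative[OF assms(1,2,5,6), of u]
      pos_semidef_kron_diagonal_left[OF assms(7,3,4), of u]
    by (simp add: block_potential_def stiffness_def matrix_vector_mult_add_rdistrib inner_add_right)
qed

text \<open>
  On the left, the weak form of \<open>block_rhs\<close> has one half of the flux term left and lacks the
  contributions of the test function \<open>\<psi>\<close> to the jump.  By adjointness of \<open>P\<close> and \<open>Q\<close>, these missing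
  terms are what the right block supplies: its SAT 3 term for the penalty, and its term in the jump
  of the derivative for the flux; and vice versa.
\<close>

lemma weak_coupled_rhs:
  assumes pd: "pos_def Hux" "pos_def Huy" "pos_def Hvx" "pos_def Hvy"
    and nc: "norm_compatible Huy Hvy P Q"
  shows "\<phi> \<bullet> ((Hux \<otimes> Huy) *v block_rhs s r r' Hux Mux Sux Huy Muy Suy Svx P Q \<tau> u v)
      + \<psi> \<bullet> ((Hvx \<otimes> Hvy) *v block_rhs (- s) r' r Hvx Mvx Svx Hvy Mvy Svy Sux Q P \<tau> v u)
    = - (block_potential s r r' Hux Mux Sux Huy Muy Q \<tau> \<phi> \<psi> u v
       + block_potential (- s) r' r Hvx Mvx Svx Hvy Mvy P \<tau> \<psi> \<phi> v u)"
proof -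
  have adj: "x \<bullet> (Huy *v (Q *v y)) = (P *v x) \<bullet> (Hvy *v y)" for x y
  proof -
    have "x \<bullet> ((Huy ** Q) *v y) = ((Hvy ** P) *v x) \<bullet> y"
      using nc inner_matrix_vector[of x "Huy ** Q" y]
      by (simp add: norm_compatible_def del: transpose_matrix_vector)
    then show ?thesis
      using symmetric_inner_commute[of Hvy "P *v x" y] pd(4)
      by (simp add: matrix_vector_mul_assoc pos_def_def inner_commute)
  qed
  have adj': "y \<bullet> (Hvy *v (P *v x)) = (Q *v y) \<bullet> (Huy *v x)" for x y
    using adj[of x y] symmetric_inner_commute[of Hvy y "P *v x"]
      symmetric_inner_commute[of Huy x "Q *v y"] pd by (simp add: pos_def_def)
  show ?thesis
    unfolding weak_block_rhs[OF pd(1,2) refl] weak_block_rhs[OF pd(3,4) refl] block_potential_def coupling_def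
    by (simp add: matrix_vector_mult_diff_distrib inner_diff_left inner_diff_right adj adj' algebra_simps)
qed

section \<open>Energy conservation\<close>

text \<open>
  Testing the equations with the velocities shows that the kinetic energy loses
  \<open>2 b (u_t, v_t) (u, v)\<close> per unit time, which by symmetry is the rate at which \<open>b\<close> gains.
\<close>

lemma energy_stableI:
  fixes b :: "(real ^ 'm::finite) \<times> (real ^ 'n::finite) \<Rightarrow> (real ^ 'm) \<times> (real ^ 'n) \<Rightarrow> real"
  assumes Hu: "pos_semidef Hu" and Hv: "pos_semidef Hv"
    and b: "bilinear b" and sym: "\<And>x y. b x y = b y x" and nonneg: "\<And>x. b x x \<ge> 0"
    and weak: "\<And>\<phi> \<psi> u v. \<phi> \<bullet> (Hu *v Fu u v) + \<psi> \<bullet> (Hv *v Fv u v) = - b (\<phi>, \<psi>) (u, v)"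
  shows "energy_stable Hu Hv Fu Fv"
  unfolding energy_stable_def
proof (intro exI[of _ "\<lambda>x. b x x"] conjI allI impI)
  show "quadratic_form (\<lambda>x. b x x)"
    using b unfolding quadratic_form_def by blast
  show "b (u, v) (u, v) \<ge> 0" for u v
    by (rule nonneg)
  show "energy Hu Hv (\<lambda>x. b x x) u v ut vt \<ge> 0" for u v ut vt
    using Hu Hv nonneg unfolding energy_def pos_semidef_def by (simp add: add_nonneg_nonneg)
next
  fix u v ut vt and t :: real
  assume sol: "solves Fu Fv u v ut vt" and t: "t \<ge> 0"
  let ?F = "at t within {0..}"
  have d: "(u has_vector_derivative ut t) ?F" "(v has_vector_derivative vt t) ?F"
    "(ut has_vector_derivative Fu (u t) (v t)) ?F" "(vt has_vector_derivative Fv (u t) (v t)) ?F"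
    using sol t unfolding solves_def by auto
  have kin: "((\<lambda>s. w s \<bullet> (H *v w s)) has_vector_derivative 2 * (w t \<bullet> (H *v w'))) ?F"
    if "(w has_vector_derivative w') ?F" "pos_semidef H" for w w' and H :: "'k::finite sqmat"
  proof -
    have "((\<lambda>s. w s \<bullet> (H *v w s)) has_vector_derivative (w t \<bullet> (H *v w') + w' \<bullet> (H *v w t))) ?F"
      by (intro bounded_bilinear.has_vector_derivative[OF bounded_bilinear_inner] that(1)
          bounded_linear.has_vector_derivative[OF matrix_vector_mul_bounded_linear])
    then show ?thesis
      using symmetric_inner_commute[of H w' "w t"] that(2) by (simp add: pos_semidef_def)
  qed
  have bb: "bounded_bilinear b"
    using b bilinear_conv_bounded_bilinear by blast
  have "((\<lambda>s. b (u s, v s) (u s, v s)) has_vector_derivative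
      b (u t, v t) (ut t, vt t) + b (ut t, vt t) (u t, v t)) ?F"
    by (intro bounded_bilinear.has_vector_derivative[OF bb] has_vector_derivative_Pair d)
  then have "((\<lambda>s. energy Hu Hv (\<lambda>x. b x x) (u s) (v s) (ut s) (vt s)) has_vector_derivative
      2 * (ut t \<bullet> (Hu *v Fu (u t) (v t))) + 2 * (vt t \<bullet> (Hv *v Fv (u t) (v t)))
      + (b (u t, v t) (ut t, vt t) + b (ut t, vt t) (u t, v t))) ?F"
    unfolding energy_def
    by (intro has_vector_derivative_add kin d Hu Hv)
  moreover have "2 * (ut t \<bullet> (Hu *v Fu (u t) (v t))) + 2 * (vt t \<bullet> (Hv *v Fv (u t) (v t)))
      + (b (u t, v t) (ut t, vt t) + b (ut t, vt t) (u t, v t)) = 0"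
    using weak[of "ut t" "u t" "v t" "vt t"] sym[of "(u t, v t)" "(ut t, vt t)"] by simp
  ultimately show "((\<lambda>s. energy Hu Hv (\<lambda>x. b x x) (u s) (v s) (ut s) (vt s)) has_real_derivative 0) ?F"
    by (simp add: has_real_derivative_iff_has_vector_derivative)
qed

lemma pos_semidef_kron_diagonal:
  assumes "diagonal A" "pos_semidef A" "diagonal B" "pos_semidef B"
  shows "pos_semidef (A \<otimes> B)"
  using assms pos_semidef_kron_diagonal_right[of A B]
  by (simp add: pos_semidef_def transpose_kron)

lemma spacing_pos: "CARD('n::finite) \<ge> 2 \<Longrightarrow> a < b \<Longrightarrow> spacing TYPE('n) a b > 0"
  by (simp add: spacing_def)

theorem theorem1:
  fixes Hux Mux Sux :: "'ux::{finite,linorder} sqmat"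
    and Huy Muy Suy :: "'uy::{finite,linorder} sqmat"
    and Hvx Mvx Svx :: "'vx::{finite,linorder} sqmat"
    and Hvy Mvy Svy :: "'vy::{finite,linorder} sqmat"
    and Iu2v :: "((real, 'uy) vec, 'vy) vec" and Iv2u :: "((real, 'vy) vec, 'uy) vec"
    and hux huy hvx hvy \<theta> \<tau> :: real and p :: nat
  assumes "hux = spacing TYPE('ux) 0 (1/2)" and "huy = spacing TYPE('uy) 0 1"
    and "hvx = spacing TYPE('vx) (1/2) 1" and "hvy = spacing TYPE('vy) 0 1"
    and "sbp_operator p 0 (1/2) Hux Mux Sux" and "sbp_operator p 0 1 Huy Muy Suy"
    and "sbp_operator p (1/2) 1 Hvx Mvx Svx" and "sbp_operator p 0 1 Hvy Mvy Svy"
    and "\<theta> > 0"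
    and "borrowing \<theta> hux Mux E_ux Sux" and "borrowing \<theta> huy Muy 0 Suy"
    and "borrowing \<theta> hvx Mvx (- E_vx) Svx" and "borrowing \<theta> hvy Mvy 0 Svy"
    and "norm_compatible Huy Hvy Iu2v Iv2u"
    and "\<tau> \<ge> max (1 / (2 * \<theta> * hux)) (1 / (2 * \<theta> * hvx))"
  shows "energy_stable (Hux \<otimes> Huy) (Hvx \<otimes> Hvy)
    (\<lambda>u v. D_u Hux Mux Sux Huy Muy Suy *v u
       + SAT_u1 Hux Sux Iv2u u v + SAT_u2 Hux \<tau> Iv2u u v
       + SAT_u3 Hux \<tau> Iu2v Iv2u u v + SAT_du Hux Sux Svx Iv2u u v)
    (\<lambda>u v. D_v Hvx Mvx Svx Hvy Mvy Svy *v v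
       + SAT_v1 Hvx Svx Iu2v u v + SAT_v2 Hvx \<tau> Iu2v u v
       + SAT_v3 Hvx \<tau> Iu2v Iv2u u v + SAT_dv Hvx Sux Svx Iu2v u v)"
proof -
  have u: "diagonal Hux" "pos_def Hux" "pos_semidef Mux" "diagonal Huy" "pos_def Huy" "pos_semidef Muy"
    and v: "diagonal Hvx" "pos_def Hvx" "pos_semidef Mvx" "diagonal Hvy" "pos_def Hvy" "pos_semidef Mvy"
    using assms(5-8) by (auto simp: sbp_operator_def)
  note psd = u(3,6) v(3,6) u(2,5)[THEN pos_def_imp_pos_semidef] v(2,5)[THEN pos_def_imp_pos_semidef]
  have h: "hux > 0" "hvx > 0"
    using assms(1,3,5,7) by (auto simp: sbp_operator_def intro!: spacing_pos)
  have \<tau>: "\<tau> \<ge> 1 / (2 * \<theta> * hux)" "\<tau> \<ge> 1 / (2 * \<theta> * hvx)"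
    using assms(15) by auto
  \<comment> \<open>The right block sees itself first, hence the exchanged components in the second form.\<close>
  let ?bu = "\<lambda>x y. block_potential 1 last_pt first_pt Hux Mux Sux Huy Muy Iv2u \<tau> (fst x) (snd x) (fst y) (snd y)"
  let ?bv = "\<lambda>x y. block_potential (- 1) first_pt last_pt Hvx Mvx Svx Hvy Mvy Iu2v \<tau> (snd x) (fst x) (snd y) (fst y)"
  have sym: "?bu x y + ?bv x y = ?bu y x + ?bv y x" for x y
    using psd by (intro arg_cong2[where f = "(+)"] block_potential_commute) (auto simp: pos_semidef_def)
  have lin: "linear (\<lambda>x. ?bu x y + ?bv x y)" for y
    by (rule linearI) (simp_all add: block_potential_linear_left algebra_simps)
  have bil: "bilinear (\<lambda>x y. ?bu x y + ?bv x y)"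
    unfolding bilinear_def using lin sym by (simp add: lin)
  have nonneg: "?bu x x + ?bv x x \<ge> 0" for x
    using block_potential_nonneg[of \<theta> hux Mux 1 last_pt Sux Hux Huy Muy \<tau> first_pt Iv2u "fst x" "snd x"]
      block_potential_nonneg[of \<theta> hvx Mvx "- 1" first_pt Svx Hvx Hvy Mvy \<tau> last_pt Iu2v "snd x" "fst x"]
      assms(9,10,12) u v psd h \<tau>
    by (simp add: E_ux_def E_vx_def)
  have Euv: "E_uv = unit_entry last_pt first_pt" "E_vu = unit_entry first_pt last_pt"
    by (auto simp: E_uv_def E_vu_def unit_entry_def transpose_def vec_eq_iff)
  have Fu: "D_u Hux Mux Sux Huy Muy Suy *v u
       + SAT_u1 Hux Sux Iv2u u v + SAT_u2 Hux \<tau> Iv2u u v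
       + SAT_u3 Hux \<tau> Iu2v Iv2u u v + SAT_du Hux Sux Svx Iv2u u v
     = block_rhs 1 last_pt first_pt Hux Mux Sux Huy Muy Suy Svx Iu2v Iv2u \<tau> u v" for u v
    by (simp add: block_rhs_def Let_def D_u_def SAT_u1_def SAT_u2_def SAT_u3_def SAT_du_def Euv E_ux_def)
  have Fv: "D_v Hvx Mvx Svx Hvy Mvy Svy *v v
       + SAT_v1 Hvx Svx Iu2v u v + SAT_v2 Hvx \<tau> Iu2v u v
       + SAT_v3 Hvx \<tau> Iu2v Iv2u u v + SAT_dv Hvx Sux Svx Iu2v u v
     = block_rhs (- 1) first_pt last_pt Hvx Mvx Svx Hvy Mvy Svy Sux Iv2u Iu2v \<tau> v u" for u v
    by (simp add: block_rhs_def Let_def D_v_def SAT_v1_def SAT_v2_def SAT_v3_def SAT_dv_def Euv E_vx_def)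
  show ?thesis
    unfolding Fu Fv
  proof (rule energy_stableI[OF _ _ bil sym nonneg])
    show "pos_semidef (Hux \<otimes> Huy)" "pos_semidef (Hvx \<otimes> Hvy)"
      using u v psd by (auto intro: pos_semidef_kron_diagonal)
  qed (simp add: weak_coupled_rhs[OF u(2,5) v(2,5) assms(14), of _ 1])
qed

end
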